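(* Let $M=M_1\oplus M_2$ be a right $R$-module, where $M_1$ and $M_2$ are CLS-modules. If $M_1$ is $M_2$-ejective, then $M$ is a CLS-module.
   Context: $R$ is an associative ring with identity and all modules are unital right $R$-modules. For submodules $S\leq M$, $S$ is essential in $M$ ($S\leq_e M$) if for any $T\leq M$, $S\cap T=0$ implies $T=0$. The singular submodule is $Z(M)=\{m\in M : mI=0 \text{ for some essential right ideal } I \text{ of } R\}$, and $M$ is nonsingular if $Z(M)=0$. A submodule $N\leq M$ is $\mathscr{S}$-closed in $M$ if $M/N$ is nonsingular. $M$ is a CLS-module if every $\mathscr{S}$-closed submodule of $M$ is a direct summand of $M$. For modules $M_1,M_2$ with $M=M_1\oplus M_2$, $M_1$ is $M_2$-ejective if for every submodule $K$ of $M$ with $K\cap M_1=0$ there exists a submodule $M_3$ of $M$ such that $M=M_1\oplus M_3$ and $K\cap M_3\leq_e K$. *)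

theory Defs
  imports "HOL-Algebra.Module" "HOL-Algebra.AbelCoset"
begin

text \<open>The library's modules are over commutative rings only. As in its record for them, the
  underlying abelian group of a module is the additive part of a ring record, whose
  multiplicative fields carry no meaning.\<close>

record ('a, 'b) rmodule = "'b ring" +
  rsmult :: "['b, 'a] \<Rightarrow> 'b" (infixl \<open>\<bullet>\<index>\<close> 70)

locale right_module = R?: ring R + M?: abelian_group M
  for R :: "('a, 'r) ring_scheme" (structure) and M :: "('a, 'b, 'm) rmodule_scheme" (structure) +
  assumes rsmult_closed [simp, intro]:
      "\<lbrakk>x \<in> carrier M; a \<in> carrier R\<rbrakk> \<Longrightarrow> x \<bullet>\<^bsub>M\<^esub> a \<in> carrier M"
    and rsmult_r_distr:
      "\<lbrakk>x \<in> carrier M; a \<in> carrier R; b \<in> carrier R\<rbrakk> \<Longrightarrow>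
        x \<bullet>\<^bsub>M\<^esub> (a \<oplus>\<^bsub>R\<^esub> b) = x \<bullet>\<^bsub>M\<^esub> a \<oplus>\<^bsub>M\<^esub> x \<bullet>\<^bsub>M\<^esub> b"
    and rsmult_l_distr:
      "\<lbrakk>x \<in> carrier M; y \<in> carrier M; a \<in> carrier R\<rbrakk> \<Longrightarrow>
        (x \<oplus>\<^bsub>M\<^esub> y) \<bullet>\<^bsub>M\<^esub> a = x \<bullet>\<^bsub>M\<^esub> a \<oplus>\<^bsub>M\<^esub> y \<bullet>\<^bsub>M\<^esub> a"
    and rsmult_assoc:
      "\<lbrakk>x \<in> carrier M; a \<in> carrier R; b \<in> carrier R\<rbrakk> \<Longrightarrow>
        x \<bullet>\<^bsub>M\<^esub> (a \<otimes>\<^bsub>R\<^esub> b) = (x \<bullet>\<^bsub>M\<^esub> a) \<bullet>\<^bsub>M\<^esub> b"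
    and rsmult_one [simp]:
      "x \<in> carrier M \<Longrightarrow> x \<bullet>\<^bsub>M\<^esub> \<one>\<^bsub>R\<^esub> = x"

locale right_submodule = additive_subgroup N M
  for N and R :: "('a, 'r) ring_scheme" and M :: "('a, 'b, 'm) rmodule_scheme" (structure) +
  assumes rsmult_closed:
      "\<lbrakk>x \<in> N; a \<in> carrier R\<rbrakk> \<Longrightarrow> x \<bullet>\<^bsub>M\<^esub> a \<in> N"

abbreviation restrict_to ::
  "('a, 'b, 'm) rmodule_scheme \<Rightarrow> 'b set \<Rightarrow> ('a, 'b, 'm) rmodule_scheme"
  where "restrict_to M N \<equiv> M\<lparr>carrier := N\<rparr>"

definition regular_module :: "('a, 'r) ring_scheme \<Rightarrow> ('a, 'a) rmodule"
  where "regular_module R =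
    \<lparr>carrier = carrier R, mult = mult R, one = one R, zero = zero R, add = add R,
      rsmult = mult R\<rparr>"

definition quotient_module ::
  "('a, 'b, 'm) rmodule_scheme \<Rightarrow> 'b set \<Rightarrow> ('a, 'b set) rmodule"
  where "quotient_module M N =
    \<lparr>carrier = a_rcosets\<^bsub>M\<^esub> N, mult = undefined, one = undefined, zero = N, add = set_add M,
      rsmult = (\<lambda>X a. \<Union>x\<in>X. N +>\<^bsub>M\<^esub> (x \<bullet>\<^bsub>M\<^esub> a))\<rparr>"

definition direct_sum ::
  "('a, 'r) ring_scheme \<Rightarrow> ('a, 'b, 'm) rmodule_scheme \<Rightarrow> 'b set \<Rightarrow> 'b set \<Rightarrow> bool"
  where "direct_sum R M A B \<longleftrightarrow>
    right_submodule A R M \<and> right_submodule B R M \<and>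
    A \<inter> B = {\<zero>\<^bsub>M\<^esub>} \<and> A <+>\<^bsub>M\<^esub> B = carrier M"

definition direct_summand ::
  "('a, 'r) ring_scheme \<Rightarrow> ('a, 'b, 'm) rmodule_scheme \<Rightarrow> 'b set \<Rightarrow> bool"
  where "direct_summand R M A \<longleftrightarrow> (\<exists>B. direct_sum R M A B)"

definition essential ::
  "('a, 'r) ring_scheme \<Rightarrow> ('a, 'b, 'm) rmodule_scheme \<Rightarrow> 'b set \<Rightarrow> bool"
  where "essential R M S \<longleftrightarrow>
    right_submodule S R M \<and>
    (\<forall>T. right_submodule T R M \<and> S \<inter> T = {\<zero>\<^bsub>M\<^esub>} \<longrightarrow> T = {\<zero>\<^bsub>M\<^esub>})"

definition singular_submodule ::
  "('a, 'r) ring_scheme \<Rightarrow> ('a, 'b, 'm) rmodule_scheme \<Rightarrow> 'b set"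
  where "singular_submodule R M =
    {m \<in> carrier M. \<exists>I. essential R (regular_module R) I \<and> (\<forall>a\<in>I. m \<bullet>\<^bsub>M\<^esub> a = \<zero>\<^bsub>M\<^esub>)}"

definition nonsingular ::
  "('a, 'r) ring_scheme \<Rightarrow> ('a, 'b, 'm) rmodule_scheme \<Rightarrow> bool"
  where "nonsingular R M \<longleftrightarrow> singular_submodule R M = {\<zero>\<^bsub>M\<^esub>}"

definition S_closed ::
  "('a, 'r) ring_scheme \<Rightarrow> ('a, 'b, 'm) rmodule_scheme \<Rightarrow> 'b set \<Rightarrow> bool"
  where "S_closed R M N \<longleftrightarrow> right_submodule N R M \<and> nonsingular R (quotient_module M N)"

definition CLS_module ::
  "('a, 'r) ring_scheme \<Rightarrow> ('a, 'b, 'm) rmodule_scheme \<Rightarrow> bool"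
  where "CLS_module R M \<longleftrightarrow>
    right_module R M \<and> (\<forall>N. S_closed R M N \<longrightarrow> direct_summand R M N)"

text \<open>\<open>ejective R M M\<^sub>1 M\<^sub>2\<close>: the submodule \<open>M\<^sub>1\<close> is \<open>M\<^sub>2\<close>-ejective with respect to the internal
  decomposition \<open>M = M\<^sub>1 \<oplus> M\<^sub>2\<close>.\<close>

definition ejective ::
  "('a, 'r) ring_scheme \<Rightarrow> ('a, 'b, 'm) rmodule_scheme \<Rightarrow> 'b set \<Rightarrow> 'b set \<Rightarrow> bool"
  where "ejective R M M\<^sub>1 M\<^sub>2 \<longleftrightarrow>
    direct_sum R M M\<^sub>1 M\<^sub>2 \<and>
    (\<forall>K. right_submodule K R M \<and> K \<inter> M\<^sub>1 = {\<zero>\<^bsub>M\<^esub>} \<longrightarrow>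
      (\<exists>M\<^sub>3. direct_sum R M M\<^sub>1 M\<^sub>3 \<and> essential R (restrict_to M K) (K \<inter> M\<^sub>3)))"

lemma (in ring) regular_module_is_right_module: "right_module R (regular_module R)"
proof -
  have "abelian_group (regular_module R)"
    by (rule abelian_groupI) (auto simp: regular_module_def a_ac intro: l_neg bexI[of _ "\<ominus> _"])
  then show ?thesis
    by (intro right_module.intro right_module_axioms.intro ring_axioms)
      (auto simp: regular_module_def l_distr r_distr m_assoc)
qed

lemma (in right_module) submodule_is_right_module:
  assumes "right_submodule N R M"
  shows "right_module R (restrict_to M N)"
proof -
  interpret N: right_submodule N R M by fact
  have "abelian_group (restrict_to M N)"
  proof (rule abelian_groupI)
    fix x assume "x \<in> carrier (restrict_to M N)"
    then show "\<exists>y\<in>carrier (restrict_to M N). y \<oplus>\<^bsub>restrict_to M N\<^esub> x = \<zero>\<^bsub>restrict_to M N\<^esub>"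
      by (intro bexI[of _ "\<ominus>\<^bsub>M\<^esub> x"]) (simp_all add: M.l_neg)
  qed (simp_all add: M.a_ac)
  then show ?thesis
    by (intro right_module.intro right_module_axioms.intro R.ring_axioms)
      (auto simp: rsmult_r_distr rsmult_l_distr rsmult_assoc N.rsmult_closed)
qed

lemma (in right_module) rsmult_coset:
  assumes "right_submodule N R M" "x \<in> carrier M" "a \<in> carrier R"
  shows "(N +>\<^bsub>M\<^esub> x) \<bullet>\<^bsub>quotient_module M N\<^esub> a = N +>\<^bsub>M\<^esub> (x \<bullet>\<^bsub>M\<^esub> a)"
proof -
  interpret N: right_submodule N R M by fact
  interpret N: abelian_subgroup N M
    by (rule abelian_subgroupI3) unfold_locales
  have "N +>\<^bsub>M\<^esub> (y \<bullet>\<^bsub>M\<^esub> a) = N +>\<^bsub>M\<^esub> (x \<bullet>\<^bsub>M\<^esub> a)" if "y \<in> N +>\<^bsub>M\<^esub> x" for y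
  proof -
    from that obtain n where n: "n \<in> N" "y = n \<oplus>\<^bsub>M\<^esub> x"
      by (auto simp: a_r_coset_def')
    then have "y \<bullet>\<^bsub>M\<^esub> a = n \<bullet>\<^bsub>M\<^esub> a \<oplus>\<^bsub>M\<^esub> x \<bullet>\<^bsub>M\<^esub> a"
      using assms by (simp add: rsmult_l_distr)
    moreover have "n \<bullet>\<^bsub>M\<^esub> a \<in> N"
      using n assms by (simp add: N.rsmult_closed)
    ultimately have *: "y \<bullet>\<^bsub>M\<^esub> a \<in> N +>\<^bsub>M\<^esub> (x \<bullet>\<^bsub>M\<^esub> a)"
      by (auto simp: a_r_coset_def')
    have "x \<bullet>\<^bsub>M\<^esub> a \<in> carrier M"
      using assms by simp
    with * show ?thesis
      by (rule M.a_repr_independence'[OF _ _ N.a_subgroup, folded a_r_coset_def, symmetric])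
  qed
  moreover have "x \<in> N +>\<^bsub>M\<^esub> x"
    using assms by (simp add: N.a_rcos_self)
  ultimately have "(\<Union>y\<in>N +>\<^bsub>M\<^esub> x. N +>\<^bsub>M\<^esub> (y \<bullet>\<^bsub>M\<^esub> a)) = N +>\<^bsub>M\<^esub> (x \<bullet>\<^bsub>M\<^esub> a)"
    by blast
  then show ?thesis
    by (simp add: quotient_module_def)
qed

lemma (in right_module) quotient_is_right_module:
  assumes "right_submodule N R M"
  shows "right_module R (quotient_module M N)"
proof -
  interpret N: right_submodule N R M by fact
  interpret N: abelian_subgroup N M
    by (rule abelian_subgroupI3) unfold_locales
  let ?Q = "quotient_module M N"
  have carrier: "carrier ?Q = (\<lambda>x. N +>\<^bsub>M\<^esub> x) ` carrier M"
    by (auto simp: quotient_module_def A_RCOSETS_def')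
  have add: "(N +>\<^bsub>M\<^esub> x) \<oplus>\<^bsub>?Q\<^esub> (N +>\<^bsub>M\<^esub> y) = N +>\<^bsub>M\<^esub> (x \<oplus>\<^bsub>M\<^esub> y)"
    if "x \<in> carrier M" "y \<in> carrier M" for x y
    using that by (simp add: quotient_module_def N.a_rcos_sum)
  have zero: "\<zero>\<^bsub>?Q\<^esub> = N +>\<^bsub>M\<^esub> \<zero>\<^bsub>M\<^esub>"
    using N.a_subset by (simp add: quotient_module_def M.a_coset_add_zero)
  have "abelian_group ?Q"
  proof (rule abelian_groupI)
    fix X assume "X \<in> carrier ?Q"
    then obtain x where x: "x \<in> carrier M" "X = N +>\<^bsub>M\<^esub> x"
      by (auto simp: carrier)
    then have "(N +>\<^bsub>M\<^esub> (\<ominus>\<^bsub>M\<^esub> x)) \<oplus>\<^bsub>?Q\<^esub> X = \<zero>\<^bsub>?Q\<^esub>"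
      by (simp add: add zero M.l_neg)
    with x show "\<exists>Y\<in>carrier ?Q. Y \<oplus>\<^bsub>?Q\<^esub> X = \<zero>\<^bsub>?Q\<^esub>"
      by (auto simp: carrier)
  qed (auto simp: carrier add zero M.a_ac)
  then show ?thesis
    by (intro right_module.intro right_module_axioms.intro R.ring_axioms)
      (auto simp: carrier add rsmult_coset[OF assms] rsmult_r_distr rsmult_l_distr rsmult_assoc)
qed

end

theory Submission
  imports Defs
begin

text \<open>Let \<open>N\<close> be an S-closed submodule of \<open>M = M\<^sub>1 \<oplus> M\<^sub>2\<close>. The idea is to build a direct summand of \<open>M\<close>
  that is contained in \<open>N\<close> and essential in it; such a summand must be all of \<open>N\<close>, because its
  complement meets \<open>N\<close> trivially (\<open>direct_summand_eq_if_essential\<close>).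

  The submodule \<open>U = N \<inter> M\<^sub>1\<close> is S-closed in \<open>M\<^sub>1\<close>, so it has a complement \<open>U'\<close> there. By the modular
  law \<open>N = U \<oplus> K\<close> with \<open>K = N \<inter> (U' + M\<^sub>2)\<close>, and \<open>K\<close> meets \<open>M\<^sub>1\<close> trivially. Ejectivity therefore
  yields \<open>M = M\<^sub>1 \<oplus> M\<^sub>3\<close> with \<open>K \<inter> M\<^sub>3\<close> essential in \<open>K\<close>. Put \<open>X = N \<inter> M\<^sub>3\<close>. Then \<open>U + X\<close> lies in
  \<open>N\<close> and contains \<open>U + (K \<inter> M\<^sub>3)\<close>, which is essential in \<open>U \<oplus> K = N\<close> (\<open>essential_direct_sum\<close>).

  It remains to see that \<open>U + X\<close> is a direct summand of \<open>M\<close>. The submodule \<open>X\<close> is S-closed in \<open>M\<^sub>3\<close>.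
  As \<open>M\<^sub>2\<close> and \<open>M\<^sub>3\<close> are both complements of \<open>M\<^sub>1\<close>, projecting along \<open>M\<^sub>1\<close> identifies them, and it
  carries \<open>X\<close> to \<open>(M\<^sub>1 + X) \<inter> M\<^sub>2\<close>, which is S-closed in \<open>M\<^sub>2\<close> (\<open>S_closed_projection\<close>) and so has a
  complement \<open>Y\<close> in \<open>M\<^sub>2\<close>. Then \<open>U' + Y\<close> is a complement of \<open>U + X\<close> in \<open>M\<close> (\<open>direct_sum_exchange\<close>).\<close>

section \<open>Submodules\<close>

context right_module
begin

lemma rsmult_zero:
  assumes "x \<in> carrier M"
  shows "x \<bullet>\<^bsub>M\<^esub> \<zero>\<^bsub>R\<^esub> = \<zero>\<^bsub>M\<^esub>"
proof -
  have "x \<bullet>\<^bsub>M\<^esub> \<zero>\<^bsub>R\<^esub> \<oplus>\<^bsub>M\<^esub> x \<bullet>\<^bsub>M\<^esub> \<zero>\<^bsub>R\<^esub> = x \<bullet>\<^bsub>M\<^esub> \<zero>\<^bsub>R\<^esub>"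
    using rsmult_r_distr[of x "\<zero>\<^bsub>R\<^esub>" "\<zero>\<^bsub>R\<^esub>"] assms by simp
  then show ?thesis
    using assms by (metis M.add.r_cancel_one rsmult_closed R.zero_closed)
qed

lemma rsmult_minus_one:
  assumes "x \<in> carrier M"
  shows "x \<bullet>\<^bsub>M\<^esub> (\<ominus>\<^bsub>R\<^esub> \<one>\<^bsub>R\<^esub>) = \<ominus>\<^bsub>M\<^esub> x"
proof -
  have "x \<bullet>\<^bsub>M\<^esub> (\<ominus>\<^bsub>R\<^esub> \<one>\<^bsub>R\<^esub>) \<oplus>\<^bsub>M\<^esub> x = x \<bullet>\<^bsub>M\<^esub> (\<ominus>\<^bsub>R\<^esub> \<one>\<^bsub>R\<^esub> \<oplus>\<^bsub>R\<^esub> \<one>\<^bsub>R\<^esub>)"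
    using assms by (simp add: rsmult_r_distr)
  also have "\<dots> = \<zero>\<^bsub>M\<^esub>"
    using assms by (simp add: R.l_neg rsmult_zero)
  finally show ?thesis
    using assms by (intro M.minus_equality[symmetric]) auto
qed

text \<open>Negatives come for free, being multiples by \<open>-1\<close>. Without a clause for them,
  the criterion mentions only operations that \<open>restrict_to\<close> leaves unchanged.\<close>

lemma right_submodule_iff:
  "right_submodule N R M \<longleftrightarrow>
    N \<subseteq> carrier M \<and> \<zero>\<^bsub>M\<^esub> \<in> N \<and> (\<forall>x\<in>N. \<forall>y\<in>N. x \<oplus>\<^bsub>M\<^esub> y \<in> N) \<and>
    (\<forall>x\<in>N. \<forall>a\<in>carrier R. x \<bullet>\<^bsub>M\<^esub> a \<in> N)"
  (is "?L \<longleftrightarrow> ?R")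
proof
  assume ?L
  then interpret N: right_submodule N R M .
  show ?R
    using N.a_subset N.rsmult_closed by auto
next
  assume R: ?R
  then have "\<ominus>\<^bsub>M\<^esub> x \<in> N" if "x \<in> N" for x
    using that rsmult_minus_one[of x] by (metis R.a_inv_closed R.one_closed subsetD)
  with R have "subgroup N (add_monoid M)"
    by (intro M.add.subgroupI) (auto simp: a_inv_def)
  with R show ?L
    by (intro right_submodule.intro additive_subgroup.intro right_submodule_axioms.intro) auto
qed

lemma
  assumes "right_submodule N R M"
  shows submodule_subset: "N \<subseteq> carrier M"
    and submodule_zero: "\<zero>\<^bsub>M\<^esub> \<in> N"
    and submodule_add: "\<lbrakk>x \<in> N; y \<in> N\<rbrakk> \<Longrightarrow> x \<oplus>\<^bsub>M\<^esub> y \<in> N"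
    and submodule_rsmult: "\<lbrakk>x \<in> N; a \<in> carrier R\<rbrakk> \<Longrightarrow> x \<bullet>\<^bsub>M\<^esub> a \<in> N"
  using assms unfolding right_submodule_iff by auto

lemma submodule_minus:
  assumes "right_submodule N R M" "x \<in> N"
  shows "\<ominus>\<^bsub>M\<^esub> x \<in> N"
  using assms submodule_rsmult[of N x "\<ominus>\<^bsub>R\<^esub> \<one>\<^bsub>R\<^esub>"] submodule_subset[of N]
  by (auto simp: rsmult_minus_one)

lemma submodule_cancel:
  assumes N: "right_submodule N R M" and "x \<in> carrier M" "y \<in> N" "x \<oplus>\<^bsub>M\<^esub> y \<in> N"
  shows "x \<in> N"
proof -
  have "y \<in> carrier M"
    using assms submodule_subset[OF N] by auto
  then have "x = (x \<oplus>\<^bsub>M\<^esub> y) \<oplus>\<^bsub>M\<^esub> \<ominus>\<^bsub>M\<^esub> y"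
    using assms by (simp add: M.a_assoc M.r_neg)
  then show ?thesis
    using assms submodule_add[OF N] submodule_minus[OF N] by metis
qed

lemma submodule_carrier: "right_submodule (carrier M) R M"
  by (simp add: right_submodule_iff)

lemma submodule_Int:
  "\<lbrakk>right_submodule A R M; right_submodule B R M\<rbrakk> \<Longrightarrow> right_submodule (A \<inter> B) R M"
  unfolding right_submodule_iff by auto

lemma set_add_iff: "x \<in> A <+>\<^bsub>M\<^esub> B \<longleftrightarrow> (\<exists>a\<in>A. \<exists>b\<in>B. x = a \<oplus>\<^bsub>M\<^esub> b)"
  by (auto simp: set_add_def')

lemma set_addI: "\<lbrakk>a \<in> A; b \<in> B\<rbrakk> \<Longrightarrow> a \<oplus>\<^bsub>M\<^esub> b \<in> A <+>\<^bsub>M\<^esub> B"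
  unfolding set_add_iff by blast

lemma submodule_sum:
  assumes A: "right_submodule A R M" and B: "right_submodule B R M"
  shows "right_submodule (A <+>\<^bsub>M\<^esub> B) R M"
  unfolding right_submodule_iff
proof (intro conjI ballI subsetI)
  note sub = submodule_subset[OF A] submodule_subset[OF B]
  show "x \<in> carrier M" if "x \<in> A <+>\<^bsub>M\<^esub> B" for x
    using that sub by (auto simp: set_add_iff)
  show "\<zero>\<^bsub>M\<^esub> \<in> A <+>\<^bsub>M\<^esub> B"
    using submodule_zero[OF A] submodule_zero[OF B] by (force simp: set_add_iff)
  show "x \<oplus>\<^bsub>M\<^esub> y \<in> A <+>\<^bsub>M\<^esub> B" if xy: "x \<in> A <+>\<^bsub>M\<^esub> B" "y \<in> A <+>\<^bsub>M\<^esub> B" for x y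
  proof -
    from xy obtain a b a' b' where ab: "a \<in> A" "b \<in> B" "a' \<in> A" "b' \<in> B"
      and "x = a \<oplus>\<^bsub>M\<^esub> b" "y = a' \<oplus>\<^bsub>M\<^esub> b'"
      by (auto simp: set_add_iff)
    moreover from ab sub
    have "(a \<oplus>\<^bsub>M\<^esub> b) \<oplus>\<^bsub>M\<^esub> (a' \<oplus>\<^bsub>M\<^esub> b') = (a \<oplus>\<^bsub>M\<^esub> a') \<oplus>\<^bsub>M\<^esub> (b \<oplus>\<^bsub>M\<^esub> b')"
      by (simp add: M.a_ac subset_iff)
    ultimately show ?thesis
      using submodule_add[OF A] submodule_add[OF B] unfolding set_add_iff by metis
  qed
  show "x \<bullet>\<^bsub>M\<^esub> r \<in> A <+>\<^bsub>M\<^esub> B" if xr: "x \<in> A <+>\<^bsub>M\<^esub> B" "r \<in> carrier R" for x r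
  proof -
    from xr obtain a b where ab: "a \<in> A" "b \<in> B" and "x = a \<oplus>\<^bsub>M\<^esub> b"
      by (auto simp: set_add_iff)
    then have "x \<bullet>\<^bsub>M\<^esub> r = a \<bullet>\<^bsub>M\<^esub> r \<oplus>\<^bsub>M\<^esub> b \<bullet>\<^bsub>M\<^esub> r"
      using sub xr rsmult_l_distr[of a b r] by blast
    then show ?thesis
      using ab xr submodule_rsmult[OF A] submodule_rsmult[OF B] unfolding set_add_iff by metis
  qed
qed

lemma submodule_sum_supset:
  assumes A: "right_submodule A R M" and B: "right_submodule B R M"
  shows "A \<subseteq> A <+>\<^bsub>M\<^esub> B" and "B \<subseteq> A <+>\<^bsub>M\<^esub> B"
proof -
  show "A \<subseteq> A <+>\<^bsub>M\<^esub> B"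
    using submodule_zero[OF B] submodule_subset[OF A] by (force simp: set_add_iff)
  show "B \<subseteq> A <+>\<^bsub>M\<^esub> B"
    using submodule_zero[OF A] submodule_subset[OF B] by (force simp: set_add_iff)
qed

lemma submodule_restrict_iff:
  assumes "right_submodule N R M"
  shows "right_submodule T R (restrict_to M N) \<longleftrightarrow> right_submodule T R M \<and> T \<subseteq> N"
proof -
  interpret N: right_module R "restrict_to M N"
    by (rule submodule_is_right_module[OF assms])
  show ?thesis
    using submodule_subset[OF assms]
    unfolding N.right_submodule_iff right_submodule_iff by auto
qed

section \<open>Direct sums\<close>

lemma direct_sum_restrict_iff:
  assumes "right_submodule N R M"
  shows "direct_sum R (restrict_to M N) A B \<longleftrightarrow>
    right_submodule A R M \<and> right_submodule B R M \<and> A \<inter> B = {\<zero>\<^bsub>M\<^esub>} \<and> A <+>\<^bsub>M\<^esub> B = N"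
proof -
  have "A <+>\<^bsub>restrict_to M N\<^esub> B = A <+>\<^bsub>M\<^esub> B"
    by (simp add: set_add_def')
  then show ?thesis
    using submodule_sum_supset[of A B]
    unfolding direct_sum_def submodule_restrict_iff[OF assms] by auto
qed

lemma trivial_Int_add_zero:
  assumes A: "right_submodule A R M" and B: "right_submodule B R M" and "A \<inter> B = {\<zero>\<^bsub>M\<^esub>}"
    and "a \<in> A" "b \<in> B" "a \<oplus>\<^bsub>M\<^esub> b = \<zero>\<^bsub>M\<^esub>"
  shows "a = \<zero>\<^bsub>M\<^esub>" and "b = \<zero>\<^bsub>M\<^esub>"
proof -
  have carr: "a \<in> carrier M" "b \<in> carrier M"
    using assms submodule_subset[OF A] submodule_subset[OF B] by auto
  then have "a = \<ominus>\<^bsub>M\<^esub> b"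
    using assms by (metis M.minus_equality)
  then have "a \<in> A \<inter> B"
    using assms submodule_minus[OF B] by auto
  then show "a = \<zero>\<^bsub>M\<^esub>"
    using assms by auto
  then show "b = \<zero>\<^bsub>M\<^esub>"
    using assms carr by simp
qed

lemma trivial_IntI:
  assumes A: "right_submodule A R M" and B: "right_submodule B R M"
    and "\<And>a b. \<lbrakk>a \<in> A; b \<in> B; a \<oplus>\<^bsub>M\<^esub> b = \<zero>\<^bsub>M\<^esub>\<rbrakk> \<Longrightarrow> a = \<zero>\<^bsub>M\<^esub>"
  shows "A \<inter> B = {\<zero>\<^bsub>M\<^esub>}"
proof -
  have "x = \<zero>\<^bsub>M\<^esub>" if "x \<in> A" "x \<in> B" for x
    using that assms(3)[of x "\<ominus>\<^bsub>M\<^esub> x"] submodule_minus[OF B] submodule_subset[OF A]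
    by (auto simp: M.r_neg)
  then show ?thesis
    using submodule_zero[OF A] submodule_zero[OF B] by blast
qed

text \<open>This is the modular law. Writing \<open>n \<in> N\<close> as \<open>u + (u' + b)\<close>, the bracket differs from \<open>n\<close> by
  \<open>u \<in> U \<subseteq> N\<close> and hence lies in \<open>N\<close> as well.\<close>

lemma direct_sum_modular:
  assumes AB: "direct_sum R M A B"
    and N: "right_submodule N R M"
    and UU': "direct_sum R (restrict_to M A) U U'"
    and "U \<subseteq> N"
  shows "direct_sum R (restrict_to M N) U (N \<inter> (U' <+>\<^bsub>M\<^esub> B))"
proof -
  have A: "right_submodule A R M" and B: "right_submodule B R M"
    and AB0: "A \<inter> B = {\<zero>\<^bsub>M\<^esub>}" and ABM: "A <+>\<^bsub>M\<^esub> B = carrier M"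
    using AB by (auto simp: direct_sum_def)
  have U: "right_submodule U R M" and U': "right_submodule U' R M"
    and UU0: "U \<inter> U' = {\<zero>\<^bsub>M\<^esub>}" and UUA: "U <+>\<^bsub>M\<^esub> U' = A"
    using UU' by (auto simp: direct_sum_restrict_iff[OF A])
  note carr = submodule_subset[OF U, THEN subsetD] submodule_subset[OF U', THEN subsetD]
    submodule_subset[OF B, THEN subsetD] submodule_subset[OF N, THEN subsetD]
  let ?K = "N \<inter> (U' <+>\<^bsub>M\<^esub> B)"
  have K: "right_submodule ?K R M"
    by (intro submodule_Int submodule_sum N U' B)
  have "U \<inter> ?K = {\<zero>\<^bsub>M\<^esub>}"
  proof (rule trivial_IntI[OF U K])
    fix u k assume u: "u \<in> U" and k: "k \<in> ?K" and uk: "u \<oplus>\<^bsub>M\<^esub> k = \<zero>\<^bsub>M\<^esub>"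
    obtain u' b where b: "u' \<in> U'" "b \<in> B" "k = u' \<oplus>\<^bsub>M\<^esub> b"
      using k by (auto simp: set_add_iff)
    have "(u \<oplus>\<^bsub>M\<^esub> u') \<oplus>\<^bsub>M\<^esub> b = \<zero>\<^bsub>M\<^esub>"
      using u b uk carr by (simp add: M.a_assoc)
    moreover have "u \<oplus>\<^bsub>M\<^esub> u' \<in> A"
      using u b UUA set_addI by blast
    ultimately have "u \<oplus>\<^bsub>M\<^esub> u' = \<zero>\<^bsub>M\<^esub>"
      using trivial_Int_add_zero[OF A B AB0] b by blast
    then show "u = \<zero>\<^bsub>M\<^esub>"
      using trivial_Int_add_zero[OF U U' UU0] u b by blast
  qed
  moreover have "U <+>\<^bsub>M\<^esub> ?K = N"
  proof
    show "U <+>\<^bsub>M\<^esub> ?K \<subseteq> N"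
      using \<open>U \<subseteq> N\<close> submodule_add[OF N] unfolding set_add_def' by blast
    show "N \<subseteq> U <+>\<^bsub>M\<^esub> ?K"
    proof
      fix n assume n: "n \<in> N"
      then have "n \<in> A <+>\<^bsub>M\<^esub> B"
        using carr ABM by auto
      then obtain a b where "a \<in> A" and b: "b \<in> B" "n = a \<oplus>\<^bsub>M\<^esub> b"
        by (auto simp: set_add_iff)
      then obtain u u' where u: "u \<in> U" "u' \<in> U'" "a = u \<oplus>\<^bsub>M\<^esub> u'"
        using UUA by (auto simp: set_add_iff)
      have n_eq: "n = u \<oplus>\<^bsub>M\<^esub> (u' \<oplus>\<^bsub>M\<^esub> b)"
        using u b carr by (simp add: M.a_assoc)
      have "(u' \<oplus>\<^bsub>M\<^esub> b) \<oplus>\<^bsub>M\<^esub> u \<in> N"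
        using n n_eq u b carr by (simp add: M.a_comm)
      then have "u' \<oplus>\<^bsub>M\<^esub> b \<in> N"
        using submodule_cancel[OF N] u b carr \<open>U \<subseteq> N\<close> by blast
      then show "n \<in> U <+>\<^bsub>M\<^esub> ?K"
        using n_eq u b set_addI by auto
    qed
  qed
  ultimately show ?thesis
    unfolding direct_sum_restrict_iff[OF N] using U K by blast
qed

text \<open>The complement of \<open>N \<inter> A\<close> found by the modular law satisfies the hypothesis under which
  ejectivity may be applied: since \<open>U' \<subseteq> A\<close>, the intersection of \<open>U' + B\<close> with \<open>A\<close> is just \<open>U'\<close>.\<close>

lemma modular_complement_trivial_Int:
  assumes AB: "direct_sum R M A B"
    and N: "right_submodule N R M"
    and UU': "direct_sum R (restrict_to M A) (N \<inter> A) U'"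
  shows "N \<inter> (U' <+>\<^bsub>M\<^esub> B) \<inter> A = {\<zero>\<^bsub>M\<^esub>}"
proof -
  have A: "right_submodule A R M" and B: "right_submodule B R M"
    and AB0: "A \<inter> B = {\<zero>\<^bsub>M\<^esub>}"
    using AB by (auto simp: direct_sum_def)
  have U': "right_submodule U' R M" and UU0: "N \<inter> A \<inter> U' = {\<zero>\<^bsub>M\<^esub>}"
    and UUA: "(N \<inter> A) <+>\<^bsub>M\<^esub> U' = A"
    using UU' by (auto simp: direct_sum_restrict_iff[OF A])
  have "U' \<subseteq> A"
    using submodule_sum_supset(2)[OF submodule_Int[OF N A] U'] UUA by simp
  have "x = \<zero>\<^bsub>M\<^esub>" if "x \<in> N" "x \<in> A" "x \<in> U' <+>\<^bsub>M\<^esub> B" for x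
  proof -
    obtain u' b where b: "u' \<in> U'" "b \<in> B" "x = u' \<oplus>\<^bsub>M\<^esub> b"
      using \<open>x \<in> U' <+>\<^bsub>M\<^esub> B\<close> by (auto simp: set_add_iff)
    have carr: "u' \<in> carrier M" "b \<in> carrier M"
      using b submodule_subset[OF U'] submodule_subset[OF B] by auto
    have "b \<in> A"
      using submodule_cancel[OF A, of b u'] b carr \<open>U' \<subseteq> A\<close> \<open>x \<in> A\<close> by (auto simp: M.a_comm)
    then have "b = \<zero>\<^bsub>M\<^esub>"
      using AB0 b by auto
    then have "x \<in> U'"
      using b carr by simp
    then show ?thesis
      using that UU0 by auto
  qed
  then show ?thesis
    using submodule_zero[OF A] submodule_zero[OF N] submodule_zero[OF submodule_sum[OF U' B]]
    by blast
qed

text \<open>Modulo \<open>A\<close>, the submodules \<open>X\<close> and \<open>(A + X) \<inter> B\<close> agree, so a complement \<open>Y\<close> of the latter in \<open>B\<close>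
  gives \<open>M = A \<oplus> X \<oplus> Y\<close>. Splitting \<open>A\<close> as \<open>U \<oplus> U'\<close> and regrouping the four summands gives the claim.\<close>

lemma direct_sum_exchange:
  assumes AB: "direct_sum R M A B"
    and AC: "direct_sum R M A C"
    and X: "right_submodule X R M" "X \<subseteq> C"
    and UU': "direct_sum R (restrict_to M A) U U'"
    and XY: "direct_sum R (restrict_to M B) ((A <+>\<^bsub>M\<^esub> X) \<inter> B) Y"
  shows "direct_sum R M (U <+>\<^bsub>M\<^esub> X) (U' <+>\<^bsub>M\<^esub> Y)"
proof -
  have A: "right_submodule A R M" and B: "right_submodule B R M"
    and C: "right_submodule C R M"
    and ABM: "A <+>\<^bsub>M\<^esub> B = carrier M" and AC0: "A \<inter> C = {\<zero>\<^bsub>M\<^esub>}"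
    using AB AC by (auto simp: direct_sum_def)
  have U: "right_submodule U R M" and U': "right_submodule U' R M"
    and UU0: "U \<inter> U' = {\<zero>\<^bsub>M\<^esub>}" and UUA: "U <+>\<^bsub>M\<^esub> U' = A"
    using UU' by (auto simp: direct_sum_restrict_iff[OF A])
  let ?P = "A <+>\<^bsub>M\<^esub> X"
  have P: "right_submodule ?P R M"
    by (rule submodule_sum[OF A X(1)])
  have Y: "right_submodule Y R M" and XY0: "?P \<inter> B \<inter> Y = {\<zero>\<^bsub>M\<^esub>}"
    and XYB: "(?P \<inter> B) <+>\<^bsub>M\<^esub> Y = B"
    using XY by (auto simp: direct_sum_restrict_iff[OF B])
  have YB: "Y \<subseteq> B"
    using submodule_sum_supset(2)[OF submodule_Int[OF P B] Y] XYB by simp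
  note carr = submodule_subset[OF U, THEN subsetD] submodule_subset[OF U', THEN subsetD]
    submodule_subset[OF A, THEN subsetD] submodule_subset[OF X(1), THEN subsetD]
    submodule_subset[OF Y, THEN subsetD] submodule_subset[OF B, THEN subsetD]
  have UX: "right_submodule (U <+>\<^bsub>M\<^esub> X) R M" and UY: "right_submodule (U' <+>\<^bsub>M\<^esub> Y) R M"
    using submodule_sum U U' X Y by auto
  have "(U <+>\<^bsub>M\<^esub> X) \<inter> (U' <+>\<^bsub>M\<^esub> Y) = {\<zero>\<^bsub>M\<^esub>}"
  proof (rule trivial_IntI[OF UX UY])
    fix p q assume "p \<in> U <+>\<^bsub>M\<^esub> X" "q \<in> U' <+>\<^bsub>M\<^esub> Y" and pq: "p \<oplus>\<^bsub>M\<^esub> q = \<zero>\<^bsub>M\<^esub>"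
    then obtain u x u' y where e: "u \<in> U" "x \<in> X" "u' \<in> U'" "y \<in> Y"
      and p: "p = u \<oplus>\<^bsub>M\<^esub> x" and q: "q = u' \<oplus>\<^bsub>M\<^esub> y"
      by (auto simp: set_add_iff)
    have uA: "u \<oplus>\<^bsub>M\<^esub> u' \<in> A"
      using e UUA set_addI by blast
    have wP: "(u \<oplus>\<^bsub>M\<^esub> u') \<oplus>\<^bsub>M\<^esub> x \<in> ?P"
      using uA e set_addI by blast
    have *: "y \<oplus>\<^bsub>M\<^esub> ((u \<oplus>\<^bsub>M\<^esub> u') \<oplus>\<^bsub>M\<^esub> x) = \<zero>\<^bsub>M\<^esub>"
      using pq e carr unfolding p q by (simp add: M.a_ac)
    \<comment> \<open>By \<open>*\<close>, \<open>y \<in> B\<close> is also the negative of an element of \<open>A + X\<close>, and \<open>Y\<close> was chosen to avoid these.\<close>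
    have "y \<in> ?P"
      by (rule submodule_cancel[OF P _ wP]) (use * e carr submodule_zero[OF P] in auto)
    then have "y = \<zero>\<^bsub>M\<^esub>"
      using e YB XY0 by blast
    with * have "(u \<oplus>\<^bsub>M\<^esub> u') \<oplus>\<^bsub>M\<^esub> x = \<zero>\<^bsub>M\<^esub>"
      using e carr by simp
    then have "u \<oplus>\<^bsub>M\<^esub> u' = \<zero>\<^bsub>M\<^esub>" "x = \<zero>\<^bsub>M\<^esub>"
      using trivial_Int_add_zero[OF A C AC0 uA] e X by blast+
    then show "p = \<zero>\<^bsub>M\<^esub>"
      using trivial_Int_add_zero(1)[OF U U' UU0 e(1,3)] p by simp
  qed
  moreover have "(U <+>\<^bsub>M\<^esub> X) <+>\<^bsub>M\<^esub> (U' <+>\<^bsub>M\<^esub> Y) = carrier M"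
  proof
    show "(U <+>\<^bsub>M\<^esub> X) <+>\<^bsub>M\<^esub> (U' <+>\<^bsub>M\<^esub> Y) \<subseteq> carrier M"
      by (intro submodule_subset submodule_sum UX UY)
    show "carrier M \<subseteq> (U <+>\<^bsub>M\<^esub> X) <+>\<^bsub>M\<^esub> (U' <+>\<^bsub>M\<^esub> Y)"
    proof
      fix m assume "m \<in> carrier M"
      then have "m \<in> A <+>\<^bsub>M\<^esub> B"
        using ABM by simp
      then obtain a b where a: "a \<in> A" and b: "b \<in> B" and m: "m = a \<oplus>\<^bsub>M\<^esub> b"
        by (auto simp: set_add_iff)
      from b have "b \<in> (?P \<inter> B) <+>\<^bsub>M\<^esub> Y"
        using XYB by simp
      then obtain w y where "w \<in> ?P" and y: "y \<in> Y" "b = w \<oplus>\<^bsub>M\<^esub> y"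
        by (auto simp: set_add_iff)
      then obtain a' x where x: "a' \<in> A" "x \<in> X" "w = a' \<oplus>\<^bsub>M\<^esub> x"
        by (auto simp: set_add_iff)
      have "a \<oplus>\<^bsub>M\<^esub> a' \<in> U <+>\<^bsub>M\<^esub> U'"
        using a x submodule_add[OF A] UUA by simp
      then obtain u u' where u: "u \<in> U" "u' \<in> U'" "a \<oplus>\<^bsub>M\<^esub> a' = u \<oplus>\<^bsub>M\<^esub> u'"
        by (auto simp: set_add_iff)
      have "m = (a \<oplus>\<^bsub>M\<^esub> a') \<oplus>\<^bsub>M\<^esub> (x \<oplus>\<^bsub>M\<^esub> y)"
        using a x y carr unfolding m by (simp add: M.a_assoc)
      also have "\<dots> = (u \<oplus>\<^bsub>M\<^esub> x) \<oplus>\<^bsub>M\<^esub> (u' \<oplus>\<^bsub>M\<^esub> y)"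
        using x y u carr unfolding u(3) by (simp add: M.a_ac)
      finally show "m \<in> (U <+>\<^bsub>M\<^esub> X) <+>\<^bsub>M\<^esub> (U' <+>\<^bsub>M\<^esub> Y)"
        using u x y set_addI by auto
    qed
  qed
  ultimately show ?thesis
    unfolding direct_sum_def using UX UY by blast
qed

section \<open>Essential submodules\<close>

lemma essential_restrict_iff:
  assumes "right_submodule N R M"
  shows "essential R (restrict_to M N) S \<longleftrightarrow> right_submodule S R M \<and> S \<subseteq> N \<and>
    (\<forall>T. right_submodule T R M \<and> T \<subseteq> N \<and> S \<inter> T = {\<zero>\<^bsub>M\<^esub>} \<longrightarrow> T = {\<zero>\<^bsub>M\<^esub>})"
  unfolding essential_def submodule_restrict_iff[OF assms] by auto

lemma essential_carrier: "essential R M (carrier M)"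
  unfolding essential_def
  using submodule_carrier submodule_subset by (auto simp: Int_absorb1)

text \<open>A submodule \<open>T\<close> of \<open>N\<close> that avoids \<open>U + L\<close> is projected to \<open>K\<close> along \<open>U\<close>, with image
  \<open>K \<inter> (T + U)\<close>. The image avoids \<open>L\<close>, so it vanishes; that is, \<open>T \<subseteq> U\<close>, which forces \<open>T = 0\<close>.\<close>

lemma essential_direct_sum:
  assumes N: "right_submodule N R M"
    and UK: "direct_sum R (restrict_to M N) U K"
    and L: "essential R (restrict_to M K) L"
  shows "essential R (restrict_to M N) (U <+>\<^bsub>M\<^esub> L)"
proof -
  have U: "right_submodule U R M" and K: "right_submodule K R M"
    and UK0: "U \<inter> K = {\<zero>\<^bsub>M\<^esub>}" and UKN: "U <+>\<^bsub>M\<^esub> K = N"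
    using UK by (auto simp: direct_sum_restrict_iff[OF N])
  have L': "right_submodule L R M" and LK: "L \<subseteq> K"
    and ess: "\<And>T. \<lbrakk>right_submodule T R M; T \<subseteq> K; L \<inter> T = {\<zero>\<^bsub>M\<^esub>}\<rbrakk> \<Longrightarrow> T = {\<zero>\<^bsub>M\<^esub>}"
    using L by (auto simp: essential_restrict_iff[OF K])
  have D: "right_submodule (U <+>\<^bsub>M\<^esub> L) R M"
    by (rule submodule_sum[OF U L'])
  note sup = submodule_sum_supset[OF U L']
  have "T = {\<zero>\<^bsub>M\<^esub>}"
    if T: "right_submodule T R M" and TN: "T \<subseteq> N" and DT: "(U <+>\<^bsub>M\<^esub> L) \<inter> T = {\<zero>\<^bsub>M\<^esub>}" for T
  proof -
    note carr = submodule_subset[OF U, THEN subsetD] submodule_subset[OF T, THEN subsetD]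
      submodule_subset[OF K, THEN subsetD]
    let ?T' = "K \<inter> (T <+>\<^bsub>M\<^esub> U)"
    have T': "right_submodule ?T' R M"
      by (intro submodule_Int submodule_sum K T U)
    have "x = \<zero>\<^bsub>M\<^esub>" if x: "x \<in> L" "x \<in> T <+>\<^bsub>M\<^esub> U" for x
    proof -
      obtain t u where t: "t \<in> T" "u \<in> U" "x = t \<oplus>\<^bsub>M\<^esub> u"
        using x by (auto simp: set_add_iff)
      have "t \<in> U <+>\<^bsub>M\<^esub> L"
        using submodule_cancel[OF D, of t u] t x sup carr by auto
      then have "t = \<zero>\<^bsub>M\<^esub>"
        using DT t by auto
      then have "x \<in> U"
        using t carr by simp
      then show ?thesis
        using x LK UK0 by auto
    qed
    then have "L \<inter> ?T' = {\<zero>\<^bsub>M\<^esub>}"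
      using submodule_zero[OF T'] submodule_zero[OF L'] by blast
    then have T'0: "?T' = {\<zero>\<^bsub>M\<^esub>}"
      using ess[OF T'] by blast
    have "T \<subseteq> U"
    proof
      fix t assume t: "t \<in> T"
      then have "t \<in> U <+>\<^bsub>M\<^esub> K"
        using TN UKN by auto
      then obtain u k where u: "u \<in> U" "k \<in> K" "t = u \<oplus>\<^bsub>M\<^esub> k"
        by (auto simp: set_add_iff)
      have "k = t \<oplus>\<^bsub>M\<^esub> \<ominus>\<^bsub>M\<^esub> u"
        using u carr by (simp add: M.a_comm[of u] M.a_assoc M.r_neg)
      then have "k \<in> T <+>\<^bsub>M\<^esub> U"
        using t u submodule_minus[OF U] unfolding set_add_iff by blast
      then have "k \<in> ?T'"
        using u by blast
      then show "t \<in> U"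
        using T'0 u carr by auto
    qed
    then show ?thesis
      using DT sup by blast
  qed
  moreover have "U <+>\<^bsub>M\<^esub> L \<subseteq> N"
    using LK UKN unfolding set_add_def' by blast
  ultimately show ?thesis
    unfolding essential_restrict_iff[OF N] using D by blast
qed

text \<open>A complement \<open>E\<close> of \<open>D\<close> meets \<open>N\<close> in a submodule that avoids \<open>S\<close>, so \<open>N \<inter> E = 0\<close>. As \<open>D \<subseteq> N\<close>, the
  \<open>E\<close>-component of an element of \<open>N\<close> lies in \<open>N \<inter> E\<close>.\<close>

lemma direct_summand_eq_if_essential:
  assumes DE: "direct_sum R M D E"
    and N: "right_submodule N R M"
    and SN: "essential R (restrict_to M N) S"
    and "S \<subseteq> D" "D \<subseteq> N"
  shows "D = N"
proof -
  have D: "right_submodule D R M" and E: "right_submodule E R M"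
    and DE0: "D \<inter> E = {\<zero>\<^bsub>M\<^esub>}" and DEM: "D <+>\<^bsub>M\<^esub> E = carrier M"
    using DE by (auto simp: direct_sum_def)
  have S: "right_submodule S R M"
    using SN by (simp add: essential_restrict_iff[OF N])
  have "S \<inter> (N \<inter> E) = {\<zero>\<^bsub>M\<^esub>}"
    using DE0 \<open>S \<subseteq> D\<close> submodule_zero[OF S] submodule_zero[OF N] submodule_zero[OF E] by auto
  then have NE: "N \<inter> E = {\<zero>\<^bsub>M\<^esub>}"
    using SN submodule_Int[OF N E] by (auto simp: essential_restrict_iff[OF N])
  have "n \<in> D" if n: "n \<in> N" for n
  proof -
    have "n \<in> D <+>\<^bsub>M\<^esub> E"
      using n submodule_subset[OF N] DEM by auto
    then obtain d e where d: "d \<in> D" "e \<in> E" "n = d \<oplus>\<^bsub>M\<^esub> e"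
      by (auto simp: set_add_iff)
    have carr: "d \<in> carrier M" "e \<in> carrier M"
      using d submodule_subset[OF D] submodule_subset[OF E] by auto
    have "e \<in> N"
      using submodule_cancel[OF N, of e d] n d carr \<open>D \<subseteq> N\<close> by (auto simp: M.a_comm)
    then have "e = \<zero>\<^bsub>M\<^esub>"
      using NE d by blast
    then show ?thesis
      using d carr by simp
  qed
  then show ?thesis
    using \<open>D \<subseteq> N\<close> by blast
qed

section \<open>S-closed submodules\<close>

lemma essential_right_ideal_subset:
  "essential R (regular_module R) I \<Longrightarrow> I \<subseteq> carrier R"
  using right_module.submodule_subset[OF R.regular_module_is_right_module]
  by (auto simp: essential_def regular_module_def)

text \<open>The singular elements of \<open>M/N\<close> are the cosets of those \<open>m\<close> that some essential right ideal
  multiplies into \<open>N\<close>. With this criterion the quotient module need not be mentioned again.\<close>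

lemma S_closed_iff:
  "S_closed R M N \<longleftrightarrow> right_submodule N R M \<and>
    (\<forall>m\<in>carrier M. \<forall>I. essential R (regular_module R) I \<and> (\<forall>a\<in>I. m \<bullet>\<^bsub>M\<^esub> a \<in> N) \<longrightarrow> m \<in> N)"
proof (cases "right_submodule N R M")
  case True
  then interpret N: right_submodule N R M .
  interpret N: abelian_subgroup N M
    by (rule abelian_subgroupI3) unfold_locales
  let ?Q = "quotient_module M N"
  have coset: "N +>\<^bsub>M\<^esub> x = N \<longleftrightarrow> x \<in> N" if "x \<in> carrier M" for x
    using that N.a_rcos_self N.a_rcos_const by blast
  have zero: "\<zero>\<^bsub>?Q\<^esub> = N"
    by (simp add: quotient_module_def)
  have carrier: "carrier ?Q = (\<lambda>x. N +>\<^bsub>M\<^esub> x) ` carrier M"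
    by (auto simp: quotient_module_def A_RCOSETS_def')
  have ann: "(\<forall>a\<in>I. (N +>\<^bsub>M\<^esub> m) \<bullet>\<^bsub>?Q\<^esub> a = N) \<longleftrightarrow> (\<forall>a\<in>I. m \<bullet>\<^bsub>M\<^esub> a \<in> N)"
    if "m \<in> carrier M" "essential R (regular_module R) I" for m I
    using that essential_right_ideal_subset[of I]
    by (auto simp: rsmult_coset[OF True] coset subset_iff)
  have sing: "N +>\<^bsub>M\<^esub> m \<in> singular_submodule R ?Q \<longleftrightarrow>
      (\<exists>I. essential R (regular_module R) I \<and> (\<forall>a\<in>I. m \<bullet>\<^bsub>M\<^esub> a \<in> N))"
    if "m \<in> carrier M" for m
    using that ann[OF that] unfolding singular_submodule_def zero carrier by blast
  \<comment> \<open>The ideal \<open>R\<close> itself is essential and shows that the zero of the quotient is singular.\<close>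
  have "essential R (regular_module R) (carrier R)"
    using right_module.essential_carrier[OF R.regular_module_is_right_module]
    by (simp add: regular_module_def)
  then have "N +>\<^bsub>M\<^esub> \<zero>\<^bsub>M\<^esub> \<in> singular_submodule R ?Q"
    using submodule_rsmult[OF True submodule_zero[OF True]] by (subst sing) auto
  then have "N \<in> singular_submodule R ?Q"
    using coset[of "\<zero>\<^bsub>M\<^esub>"] submodule_zero[OF True] by simp
  then have "nonsingular R ?Q \<longleftrightarrow> (\<forall>Z\<in>singular_submodule R ?Q. Z = N)"
    unfolding nonsingular_def zero by blast
  also have "\<dots> \<longleftrightarrow> (\<forall>m\<in>carrier M. N +>\<^bsub>M\<^esub> m \<in> singular_submodule R ?Q \<longrightarrow> N +>\<^bsub>M\<^esub> m = N)"
    using carrier by (auto simp: singular_submodule_def)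
  also have "\<dots> \<longleftrightarrow> (\<forall>m\<in>carrier M. \<forall>I. essential R (regular_module R) I \<and>
      (\<forall>a\<in>I. m \<bullet>\<^bsub>M\<^esub> a \<in> N) \<longrightarrow> m \<in> N)"
    using sing coset by auto
  finally show ?thesis
    using True by (simp add: S_closed_def)
qed (simp add: S_closed_def)

lemma S_closed_restrict_iff:
  assumes "right_submodule A R M"
  shows "S_closed R (restrict_to M A) N \<longleftrightarrow> right_submodule N R M \<and> N \<subseteq> A \<and>
    (\<forall>m\<in>A. \<forall>I. essential R (regular_module R) I \<and> (\<forall>a\<in>I. m \<bullet>\<^bsub>M\<^esub> a \<in> N) \<longrightarrow> m \<in> N)"
proof -
  interpret A: right_module R "restrict_to M A"
    by (rule submodule_is_right_module[OF assms])
  show ?thesis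
    unfolding A.S_closed_iff submodule_restrict_iff[OF assms] by simp
qed

lemma S_closed_Int:
  assumes N: "S_closed R M N" and A: "right_submodule A R M"
  shows "S_closed R (restrict_to M A) (N \<inter> A)"
proof -
  have "right_submodule (N \<inter> A) R M"
    using N A submodule_Int by (simp add: S_closed_iff)
  then show ?thesis
    using N submodule_subset[OF A] unfolding S_closed_iff S_closed_restrict_iff[OF A] by blast
qed

text \<open>Here \<open>(A + X) \<inter> B\<close> is the image of \<open>X\<close> in \<open>B\<close> under the identification \<open>C \<cong> M/A \<cong> B\<close>. If \<open>m \<in> B\<close> is
  multiplied into it by an essential right ideal \<open>I\<close> and \<open>m = a + c\<close> with \<open>a \<in> A\<close>, \<open>c \<in> C\<close>, then
  \<open>cI \<subseteq> (A + X) \<inter> C = X\<close>, whence \<open>c \<in> X\<close> and \<open>m \<in> A + X\<close>.\<close>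

lemma S_closed_projection:
  assumes AB: "direct_sum R M A B"
    and AC: "direct_sum R M A C"
    and XC: "S_closed R (restrict_to M C) X"
  shows "S_closed R (restrict_to M B) ((A <+>\<^bsub>M\<^esub> X) \<inter> B)"
proof -
  have A: "right_submodule A R M" and B: "right_submodule B R M"
    and C: "right_submodule C R M"
    and AC0: "A \<inter> C = {\<zero>\<^bsub>M\<^esub>}" and ACM: "A <+>\<^bsub>M\<^esub> C = carrier M"
    using AB AC by (auto simp: direct_sum_def)
  have X: "right_submodule X R M" "X \<subseteq> C"
    and closed: "\<And>m I. \<lbrakk>m \<in> C; essential R (regular_module R) I; \<forall>a\<in>I. m \<bullet>\<^bsub>M\<^esub> a \<in> X\<rbrakk> \<Longrightarrow> m \<in> X"
    using XC unfolding S_closed_restrict_iff[OF C] by blast+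
  let ?P = "A <+>\<^bsub>M\<^esub> X"
  have P: "right_submodule ?P R M"
    by (rule submodule_sum[OF A X(1)])
  note carr = submodule_subset[OF A, THEN subsetD] submodule_subset[OF C, THEN subsetD]
  have CP: "c \<in> X" if "c \<in> C" "c \<in> ?P" for c
  proof -
    obtain a x where x: "a \<in> A" "x \<in> X" "c = a \<oplus>\<^bsub>M\<^esub> x"
      using \<open>c \<in> ?P\<close> by (auto simp: set_add_iff)
    have "a \<in> C"
      using submodule_cancel[OF C, of a x] x \<open>c \<in> C\<close> \<open>X \<subseteq> C\<close> carr by auto
    then have "a = \<zero>\<^bsub>M\<^esub>"
      using AC0 x by blast
    then show ?thesis
      using x \<open>X \<subseteq> C\<close> carr by auto
  qed
  have "m \<in> ?P" if m: "m \<in> B" and I: "essential R (regular_module R) I"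
    and mI: "\<forall>r\<in>I. m \<bullet>\<^bsub>M\<^esub> r \<in> ?P" for m I
  proof -
    have "m \<in> A <+>\<^bsub>M\<^esub> C"
      using m ACM submodule_subset[OF B] by auto
    then obtain a c where c: "a \<in> A" "c \<in> C" "m = a \<oplus>\<^bsub>M\<^esub> c"
      by (auto simp: set_add_iff)
    have "c \<bullet>\<^bsub>M\<^esub> r \<in> X" if "r \<in> I" for r
    proof (rule CP)
      have r: "r \<in> carrier R"
        using essential_right_ideal_subset[OF I] that by auto
      then show "c \<bullet>\<^bsub>M\<^esub> r \<in> C"
        using c submodule_rsmult[OF C] by auto
      have "a \<bullet>\<^bsub>M\<^esub> r \<in> ?P"
        using submodule_rsmult[OF A c(1) r] submodule_sum_supset(1)[OF A X(1)] by auto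
      moreover have "c \<bullet>\<^bsub>M\<^esub> r \<oplus>\<^bsub>M\<^esub> a \<bullet>\<^bsub>M\<^esub> r \<in> ?P"
        using mI that c r carr by (metis rsmult_l_distr M.a_comm rsmult_closed)
      ultimately show "c \<bullet>\<^bsub>M\<^esub> r \<in> ?P"
        using submodule_cancel[OF P] c r carr rsmult_closed by blast
    qed
    then have "c \<in> X"
      using closed c I by blast
    then show ?thesis
      using c set_addI by blast
  qed
  then show ?thesis
    unfolding S_closed_restrict_iff[OF B] using submodule_Int[OF P B] by blast
qed

lemma CLS_restrict_complement:
  assumes "CLS_module R (restrict_to M A)" "S_closed R (restrict_to M A) N"
  obtains N' where "direct_sum R (restrict_to M A) N N'"
  using assms unfolding CLS_module_def direct_summand_def by blast

end

section \<open>Direct sums of CLS-modules\<close>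

theorem theorem3p5:
  fixes R :: "('a, 'r) ring_scheme" and M :: "('a, 'b, 'm) rmodule_scheme"
    and M\<^sub>1 M\<^sub>2 :: "'b set"
  assumes "ring R"
    and "right_module R M"
    and "direct_sum R M M\<^sub>1 M\<^sub>2"
    and "CLS_module R (restrict_to M M\<^sub>1)"
    and "CLS_module R (restrict_to M M\<^sub>2)"
    and "ejective R M M\<^sub>1 M\<^sub>2"
  shows "CLS_module R M"
proof -
  interpret right_module R M by fact
  have M1: "right_submodule M\<^sub>1 R M"
    using assms(3) by (auto simp: direct_sum_def)
  have "direct_summand R M N" if N: "S_closed R M N" for N
  proof -
    have N': "right_submodule N R M"
      using N by (simp add: S_closed_def)
    let ?U = "N \<inter> M\<^sub>1"
    obtain U' where U': "direct_sum R (restrict_to M M\<^sub>1) ?U U'"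
      using CLS_restrict_complement[OF assms(4) S_closed_Int[OF N M1]] .
    let ?K = "N \<inter> (U' <+>\<^bsub>M\<^esub> M\<^sub>2)"
    have UK: "direct_sum R (restrict_to M N) ?U ?K"
      by (rule direct_sum_modular[OF assms(3) N' U']) simp
    then have "right_submodule ?K R M"
      by (simp add: direct_sum_restrict_iff[OF N'])
    then obtain M\<^sub>3 where M3: "direct_sum R M M\<^sub>1 M\<^sub>3"
      and ess: "essential R (restrict_to M ?K) (?K \<inter> M\<^sub>3)"
      using assms(6) modular_complement_trivial_Int[OF assms(3) N' U']
      unfolding ejective_def by blast
    have M3': "right_submodule M\<^sub>3 R M"
      using M3 by (simp add: direct_sum_def)
    let ?X = "N \<inter> M\<^sub>3"
    have X: "right_submodule ?X R M"
      by (rule submodule_Int[OF N' M3'])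
    obtain Y where Y: "direct_sum R (restrict_to M M\<^sub>2) ((M\<^sub>1 <+>\<^bsub>M\<^esub> ?X) \<inter> M\<^sub>2) Y"
      using CLS_restrict_complement[OF assms(5)
          S_closed_projection[OF assms(3) M3 S_closed_Int[OF N M3']]] .
    have D: "direct_sum R M (?U <+>\<^bsub>M\<^esub> ?X) (U' <+>\<^bsub>M\<^esub> Y)"
      using direct_sum_exchange[OF assms(3) M3 X _ U' Y] by simp
    have "essential R (restrict_to M N) (?U <+>\<^bsub>M\<^esub> (?K \<inter> M\<^sub>3))"
      by (rule essential_direct_sum[OF N' UK ess])
    then have "?U <+>\<^bsub>M\<^esub> ?X = N"
    proof (rule direct_summand_eq_if_essential[OF D N'])
      show "?U <+>\<^bsub>M\<^esub> (?K \<inter> M\<^sub>3) \<subseteq> ?U <+>\<^bsub>M\<^esub> ?X"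
        unfolding set_add_def' by blast
      show "?U <+>\<^bsub>M\<^esub> ?X \<subseteq> N"
        using submodule_add[OF N'] unfolding set_add_def' by blast
    qed
    then show ?thesis
      using D unfolding direct_summand_def by auto
  qed
  then show ?thesis
    using assms(2) by (simp add: CLS_module_def)
qed

end
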